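(* Let $X=\{1,2\}$, let $\delta$ be a dissimilarity function, and let $\circ\colon[0,\infty)^2\to[0,\infty)$ be nondecreasing (that is, $a\circ b\le c\circ d$ whenever $a\le c$ and $b\le d$). For $f\colon X\to[0,\infty)$ and a monotone measure $\mu$ on $2^X$ put $$\mathrm{CS}(f,\mu)=\sup_{\{D_l\subset\dots\subset D_1\}\in\mathcal{H}_{\mathrm{chain}}}\ \sum_{i=1}^{l}\delta\big(\mathsf{A}^{\inf}(f|D_i),\mathsf{A}^{\inf}(f|D_{i-1})\big)\circ\mu(D_i),\qquad D_0=\emptyset .$$ (i) $\mathrm{CS}(f,\mu)=\mathfrak{C}^{\circ,\delta}_{\mu}(f)$ for every $f\colon X\to[0,\infty)$ and every symmetric monotone measure $\mu$ on $2^X$ if and only if $$\delta(x_2,0)\circ y\le\delta(x_1,0)\circ y+\delta(x_2,x_1)\circ y \qquad ( * )$$ for all $0\le x_1\le x_2<\infty$ and all $y\in[0,\infty)$. (ii) If $0\circ a=0$ for all $a\in[0,\infty)$, then $\mathrm{CS}(f,\mu)=\mathfrak{C}^{\circ,\delta}_{\mu}(f)$ for every $f\colon X\to[0,\infty)$ and every monotone measure $\mu$ on $2^X$ if and only if $( * )$ holds for all $0\le x_1\le x_2<\infty$ and all $y\in[0,\infty)$.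
   Context: A monotone measure on $2^X$ is a function $\mu\colon 2^X\to[0,\infty)$ with $\mu(\emptyset)=0$ and $\mu(C)\le\mu(D)$ whenever $C\subset D$. It is symmetric if $|C|=|D|$ implies $\mu(C)=\mu(D)$. A dissimilarity function is a map $\delta\colon[0,\infty)^2\to[0,\infty)$ such that for all $x,y,z$: (a) $\delta(x,y)=\delta(y,x)$; (b) $\delta(x,y)=0$ if and only if $x=y$; (c) if $x\le y\le z$ then $\delta(x,y)\le\delta(x,z)$ and $\delta(y,z)\le\delta(x,z)$. $\mathsf{A}^{\inf}(f|D)=\inf_{x\in D}f(x)$ for nonempty $D$, and $\mathsf{A}^{\inf}(f|\emptyset)=0$. $\mathcal{H}_{\mathrm{chain}}$ is the family of all chains $\{D_l,\dots,D_1\}$, $l\ge1$, of nonempty subsets of $X$ with strict inclusions $D_l\subset\dots\subset D_1$; for $X=\{1,2\}$ it is $\{\{\{1\}\},\{\{2\}\},\{\{1,2\}\},\{\{1\},\{1,2\}\},\{\{2\},\{1,2\}\}\}$. With $n=|X|=2$, for $f\colon X\to[0,\infty)$ let $(\cdot)$ be a permutation of $X$ with $f_{(1)}\le\dots\le f_{(n)}$, $f_{(i)}=f((i))$, $f_{(0)}=0$, $B_{(i)}=\{(i),\dots,(n)\}$. Define $$\mathfrak{C}^{\circ,\delta}_{\mu}(f)=\sum_{i=1}^n\delta(f_{(i)},f_{(i-1)})\circ\mu(B_{(i)}).$$ This does not depend on the permutation if $\mu$ is symmetric or if $0\circ b=0$ for all $b$. The operator $\mathrm{CS}$ is the special case of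 the Choquet-Sugeno-like operator $\sup_{\mathcal{D}\in\mathcal{H}}\sum_{(C,D)\in\mathcal{R}}\mathrm{L}(\mathsf{A}(f|C),\widehat{\mathsf{A}}(f|D),\mu(C),\widehat{\mu}(D))$ with $\mathcal{H}=\mathcal{H}_{\mathrm{chain}}$, $\mathcal{R}=\{(D_1,D_0),\dots,(D_l,D_{l-1})\}$, $\mathsf{A}=\widehat{\mathsf{A}}=\mathsf{A}^{\inf}$, $\mathrm{L}(x,y,z,w)=\delta(x,y)\circ z$. *)

theory Defs
  imports "HOL-Analysis.Analysis"
begin

text \<open>Objects living on the half line from 0 to infinity are rendered as functions on the type
  of reals; all hypotheses on them are restricted to nonnegative arguments, and similarly
  functions on \<open>X\<close> and set functions on the power set of \<open>X\<close> are only constrained there.\<close>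

definition nonneg_fun :: "'a set \<Rightarrow> ('a \<Rightarrow> real) \<Rightarrow> bool" where
  "nonneg_fun X f \<longleftrightarrow> (\<forall>x\<in>X. 0 \<le> f x)"

definition monotone_measure :: "'a set \<Rightarrow> ('a set \<Rightarrow> real) \<Rightarrow> bool" where
  "monotone_measure X \<mu> \<longleftrightarrow>
     (\<forall>C. C \<subseteq> X \<longrightarrow> 0 \<le> \<mu> C) \<and> \<mu> {} = 0 \<and>
     (\<forall>C D. C \<subseteq> D \<longrightarrow> D \<subseteq> X \<longrightarrow> \<mu> C \<le> \<mu> D)"

definition symmetric_measure :: "'a set \<Rightarrow> ('a set \<Rightarrow> real) \<Rightarrow> bool" where
  "symmetric_measure X \<mu> \<longleftrightarrow>
     (\<forall>C D. C \<subseteq> X \<longrightarrow> D \<subseteq> X \<longrightarrow> card C = card D \<longrightarrow> \<mu> C = \<mu> D)"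

definition dissimilarity :: "(real \<Rightarrow> real \<Rightarrow> real) \<Rightarrow> bool" where
  "dissimilarity \<delta> \<longleftrightarrow>
     (\<forall>x\<ge>0. \<forall>y\<ge>0. 0 \<le> \<delta> x y) \<and>
     (\<forall>x\<ge>0. \<forall>y\<ge>0. \<delta> x y = \<delta> y x) \<and>
     (\<forall>x\<ge>0. \<forall>y\<ge>0. \<delta> x y = 0 \<longleftrightarrow> x = y) \<and>
     (\<forall>x\<ge>0. \<forall>y\<ge>0. \<forall>z\<ge>0. x \<le> y \<longrightarrow> y \<le> z \<longrightarrow> \<delta> x y \<le> \<delta> x z \<and> \<delta> y z \<le> \<delta> x z)"

definition nondecreasing_op :: "(real \<Rightarrow> real \<Rightarrow> real) \<Rightarrow> bool" where
  "nondecreasing_op circ \<longleftrightarrow>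
     (\<forall>a\<ge>0. \<forall>b\<ge>0. 0 \<le> circ a b) \<and>
     (\<forall>a\<ge>0. \<forall>b\<ge>0. \<forall>c\<ge>0. \<forall>d\<ge>0. a \<le> c \<longrightarrow> b \<le> d \<longrightarrow> circ a b \<le> circ c d)"

definition A_inf :: "('a \<Rightarrow> real) \<Rightarrow> 'a set \<Rightarrow> real" where
  "A_inf f D = (if D = {} then 0 else (INF x\<in>D. f x))"

text \<open>A chain \<open>D\<^sub>l \<subset> \<dots> \<subset> D\<^sub>1\<close> of nonempty subsets of \<open>X\<close> is given by its
  (unique) decreasing enumeration, extended by the convention that \<open>D\<^sub>0\<close> is empty.\<close>

definition chain_enum :: "'a set \<Rightarrow> nat \<Rightarrow> (nat \<Rightarrow> 'a set) \<Rightarrow> bool" where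
  "chain_enum X l D \<longleftrightarrow>
     1 \<le> l \<and> D 0 = {} \<and>
     (\<forall>i\<in>{1..l}. D i \<noteq> {} \<and> D i \<subseteq> X) \<and>
     (\<forall>i\<in>{1..<l}. D (Suc i) \<subset> D i)"

text \<open>For finite \<open>X\<close> there are only finitely many chains, so the supremum is one of a
  finite set of reals (nonempty if \<open>X\<close> is).\<close>

definition CS ::
  "'a set \<Rightarrow> (real \<Rightarrow> real \<Rightarrow> real) \<Rightarrow> (real \<Rightarrow> real \<Rightarrow> real) \<Rightarrow> ('a \<Rightarrow> real) \<Rightarrow> ('a set \<Rightarrow> real) \<Rightarrow> real"
where
  "CS X \<delta> circ f \<mu> =
     Sup {\<Sum>i=1..l. circ (\<delta> (A_inf f (D i)) (A_inf f (D (i - 1)))) (\<mu> (D i)) | l D.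
            chain_enum X l D}"

definition sorting_perm :: "'a set \<Rightarrow> ('a \<Rightarrow> real) \<Rightarrow> (nat \<Rightarrow> 'a) \<Rightarrow> bool" where
  "sorting_perm X f \<sigma> \<longleftrightarrow>
     bij_betw \<sigma> {1..card X} X \<and>
     (\<forall>i j. 1 \<le> i \<longrightarrow> i \<le> j \<longrightarrow> j \<le> card X \<longrightarrow> f (\<sigma> i) \<le> f (\<sigma> j))"

definition ordered_value :: "('a \<Rightarrow> real) \<Rightarrow> (nat \<Rightarrow> 'a) \<Rightarrow> nat \<Rightarrow> real" where
  "ordered_value f \<sigma> i = (if i = 0 then 0 else f (\<sigma> i))"

definition choquet_sum ::
  "'a set \<Rightarrow> (real \<Rightarrow> real \<Rightarrow> real) \<Rightarrow> (real \<Rightarrow> real \<Rightarrow> real) \<Rightarrow> ('a set \<Rightarrow> real) \<Rightarrow> ('a \<Rightarrow> real)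
    \<Rightarrow> (nat \<Rightarrow> 'a) \<Rightarrow> real"
where
  "choquet_sum X \<delta> circ \<mu> f \<sigma> =
     (\<Sum>i=1..card X. circ (\<delta> (ordered_value f \<sigma> i) (ordered_value f \<sigma> (i - 1)))
                          (\<mu> (\<sigma> ` {i..card X})))"

text \<open>The permutation is an arbitrary sorting one. That it exists, and that its choice is
  irrelevant if \<open>\<mu>\<close> is symmetric or \<open>circ 0 b = 0\<close> for all \<open>b\<close>, is proved below.\<close>

definition gen_choquet ::
  "'a set \<Rightarrow> (real \<Rightarrow> real \<Rightarrow> real) \<Rightarrow> (real \<Rightarrow> real \<Rightarrow> real) \<Rightarrow> ('a set \<Rightarrow> real) \<Rightarrow> ('a \<Rightarrow> real) \<Rightarrow> real"
where
  "gen_choquet X \<delta> circ \<mu> f = choquet_sum X \<delta> circ \<mu> f (SOME \<sigma>. sorting_perm X f \<sigma>)"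

lemma chain_enum_12:
  "{D ` {1..l} | l D. chain_enum {1, 2 :: nat} l D} =
     {{{1}}, {{2}}, {{1, 2}}, {{1}, {1, 2}}, {{2}, {1, 2}}}" (is "?L = ?R")
proof (intro equalityI subsetI)
  fix \<D> assume "\<D> \<in> ?L"
  then obtain l D where D: "chain_enum {1, 2 :: nat} l D" and \<D>: "\<D> = D ` {1..l}"
    by blast
  have ne: "D i \<noteq> {} \<and> D i \<subseteq> {1, 2}" if "1 \<le> i" "i \<le> l" for i
    using D that by (auto simp: chain_enum_def)
  have dec: "D (Suc i) \<subset> D i" if "1 \<le> i" "i < l" for i
    using D that by (auto simp: chain_enum_def)
  have sub: "S = {1} \<or> S = {2} \<or> S = {1, 2}" if "S \<noteq> {}" "S \<subseteq> {1, 2}" for S :: "nat set"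
    using that by auto
  have l: "l \<ge> 1" using D by (simp add: chain_enum_def)
  have "l \<le> 2"
  proof (rule ccontr)
    assume "\<not> l \<le> 2"
    then have "D 3 \<subset> D 2" "D 2 \<subset> D 1" "D 3 \<noteq> {}" "D 1 \<subseteq> {1, 2}"
      using dec[of 2] dec[of 1] ne[of 3] ne[of 1] by (auto simp: eval_nat_numeral)
    then have "card (D 3) < card (D 2)" "card (D 2) < card (D 1)" "card (D 3) > 0"
        "card (D 1) \<le> card {1, 2 :: nat}"
      by (meson finite.emptyI finite_insert finite_subset psubset_card_mono psubset_imp_subset
          card_gt_0_iff card_mono subset_trans)+
    then show False by simp
  qed
  then consider "l = 1" | "l = 2" using l by linarith
  then show "\<D> \<in> ?R"
  proof cases
    case 1
    then have "\<D> = {D 1}" using \<D> by simp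
    moreover have "D 1 = {1} \<or> D 1 = {2} \<or> D 1 = {1, 2}"
      using sub ne[of 1] 1 by blast
    ultimately show ?thesis by (elim disjE) simp_all
  next
    case 2
    have "D 2 \<subset> D 1" using dec[of 1] 2 by (simp add: eval_nat_numeral)
    moreover have "D 1 = {1} \<or> D 1 = {2} \<or> D 1 = {1, 2}" "D 2 = {1} \<or> D 2 = {2} \<or> D 2 = {1, 2}"
      using sub ne[of 1] ne[of 2] 2 by simp_all
    moreover have "{1} \<noteq> {2::nat}" "{1,2} \<noteq> {2::nat}" "{1,2} \<noteq> {1::nat}" by auto
    ultimately have "D 1 = {1, 2}" "D 2 = {1} \<or> D 2 = {2}" by blast+
    moreover have "{1..2::nat} = {1, 2}" by auto
    then have "\<D> = {D 2, D 1}" using \<D> 2 by auto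
    ultimately show ?thesis by (elim disjE) simp_all
  qed
next
  fix \<D> assume R: "\<D> \<in> ?R"
  have one: "{S} \<in> ?L" if "S \<noteq> {}" "S \<subseteq> {1, 2}" for S :: "nat set"
  proof -
    let ?D = "\<lambda>i::nat. if i = 0 then {} else S"
    have "chain_enum {1, 2} 1 ?D" using that by (simp add: chain_enum_def)
    moreover have "{S} = ?D ` {1..1}" by simp
    ultimately show ?thesis by (intro CollectI exI conjI)
  qed
  have two: "{S, {1, 2}} \<in> ?L" if "S \<noteq> {}" "S \<subset> {1, 2}" for S :: "nat set"
  proof -
    let ?D = "\<lambda>i::nat. if i = 0 then {} else if i = 1 then {1, 2} else S"
    have e: "{1..2::nat} = {1, 2}" "{1..<2::nat} = {1}" by auto
    have "S \<subseteq> {1, 2}" using that by blast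
    then have "chain_enum {1, 2} 2 ?D" using that by (simp add: chain_enum_def e)
    moreover have "{S, {1, 2}} = ?D ` {1..2}" unfolding e by auto
    ultimately show ?thesis by (intro CollectI exI conjI)
  qed
  have "{{1}, {1, 2}} \<in> ?L" by (rule two) (simp_all add: psubset_eq)
  moreover have "{{2}, {1, 2}} \<in> ?L" by (rule two) (simp_all add: psubset_eq)
  moreover have "{{1}} \<in> ?L" by (rule one) simp_all
  moreover have "{{2}} \<in> ?L" by (rule one) simp_all
  moreover have "{{1, 2}} \<in> ?L" by (rule one) simp_all
  moreover have "\<D> = {{1}} \<or> \<D> = {{2}} \<or> \<D> = {{1, 2}} \<or> \<D> = {{1}, {1, 2}} \<or> \<D> = {{2}, {1, 2}}"
    using R by simp
  ultimately show "\<D> \<in> ?L" by (elim disjE) (erule ssubst, assumption)+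
qed

lemma sorting_perm_exists:
  assumes "finite X"
  shows "\<exists>\<sigma>. sorting_perm X f \<sigma>"
proof -
  obtain xs where xs: "set xs = X" "distinct xs"
    using finite_distinct_list[OF assms] by blast
  define ys where "ys = sort_key f xs"
  have ys: "set ys = X" "distinct ys" "sorted (map f ys)"
    unfolding ys_def using xs by simp_all
  have n: "length ys = card X"
    using distinct_card[OF ys(2)] unfolding ys(1) by (rule sym)
  have "bij_betw ((!) ys) {..<card X} X"
    by (rule bij_betw_nth[OF ys(2)]) (simp_all add: ys(1) n)
  moreover have "bij_betw (\<lambda>i. i - 1) {1..card X} {..<card X}"
    by (rule bij_betwI[where g = Suc]) auto
  ultimately have "bij_betw ((!) ys \<circ> (\<lambda>i. i - 1)) {1..card X} X"
    by (rule bij_betw_trans[rotated])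
  moreover have "f (ys ! (i - 1)) \<le> f (ys ! (j - 1))"
    if "1 \<le> i" "i \<le> j" "j \<le> card X" for i j
    using sorted_nth_mono[OF ys(3), of "i - 1" "j - 1"] that n by simp
  ultimately have "sorting_perm X f ((!) ys \<circ> (\<lambda>i. i - 1))"
    by (simp add: sorting_perm_def)
  then show ?thesis by blast
qed

lemma ordered_value_unique:
  assumes "sorting_perm X f \<sigma>" "sorting_perm X f \<tau>" "i \<le> card X"
  shows "ordered_value f \<sigma> i = ordered_value f \<tau> i"
proof (cases "i = 0")
  case False
  let ?l = "\<lambda>\<rho>. map (\<lambda>k. f (\<rho> k)) [1..<Suc (card X)]"
  have srt: "sorted (?l \<rho>)" and ms: "mset (?l \<rho>) = image_mset f (mset_set X)"
    if \<rho>: "sorting_perm X f \<rho>" for \<rho>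
  proof -
    show "sorted (?l \<rho>)"
      using \<rho> by (auto simp: sorting_perm_def sorted_iff_nth_mono simp del: upt_Suc)
    have "mset (?l \<rho>) = image_mset f (image_mset \<rho> (mset_set {1..card X}))"
      by (simp add: image_mset.compositionality comp_def atLeastLessThanSuc_atLeastAtMost
          del: upt_Suc)
    also have "image_mset \<rho> (mset_set {1..card X}) = mset_set X"
      using \<rho> by (metis bij_betw_def image_mset_mset_set sorting_perm_def)
    finally show "mset (?l \<rho>) = image_mset f (mset_set X)" .
  qed
  have "?l \<sigma> = ?l \<tau>"
    using srt[OF assms(1)] srt[OF assms(2)] ms[OF assms(1)] ms[OF assms(2)]
    by (metis properties_for_sort)
  then have "?l \<sigma> ! (i - 1) = ?l \<tau> ! (i - 1)" by (rule arg_cong)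
  then show ?thesis using False assms(3) by (simp add: ordered_value_def del: upt_Suc)
qed (simp add: ordered_value_def)

lemma gen_choquet_eq_symmetric:
  assumes "finite X" "symmetric_measure X \<mu>" "sorting_perm X f \<sigma>"
  shows "gen_choquet X \<delta> circ \<mu> f = choquet_sum X \<delta> circ \<mu> f \<sigma>"
proof -
  define \<tau> where "\<tau> = (SOME \<sigma>. sorting_perm X f \<sigma>)"
  have \<tau>: "sorting_perm X f \<tau>"
    unfolding \<tau>_def by (rule someI_ex[OF sorting_perm_exists[OF assms(1)]])
  have B: "\<rho> ` {i..card X} \<subseteq> X \<and> card (\<rho> ` {i..card X}) = card {i..card X}"
    if "sorting_perm X f \<rho>" "1 \<le> i" for \<rho> i
  proof -
    have sub: "{i..card X} \<subseteq> {1..card X}" using that(2) by auto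
    have b: "bij_betw \<rho> {1..card X} X" using that(1) by (simp add: sorting_perm_def)
    have "inj_on \<rho> {i..card X}"
      using b sub by (meson bij_betw_def inj_on_subset)
    moreover have "\<rho> ` {i..card X} \<subseteq> X"
      using b sub by (metis bij_betw_def image_mono)
    ultimately show ?thesis by (simp add: card_image)
  qed
  have "\<mu> (\<tau> ` {i..card X}) = \<mu> (\<sigma> ` {i..card X})" if "1 \<le> i" for i
    using assms(2) B[OF \<tau> that] B[OF assms(3) that] unfolding symmetric_measure_def by metis
  then show ?thesis
    unfolding gen_choquet_def \<tau>_def[symmetric] choquet_sum_def
    using ordered_value_unique[OF \<tau> assms(3)] by (intro sum.cong) auto
qed

lemma gen_choquet_eq_zero:
  assumes "finite X" "dissimilarity \<delta>" "nonneg_fun X f" "monotone_measure X \<mu>"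
    and "\<And>b. 0 \<le> b \<Longrightarrow> circ 0 b = 0" "sorting_perm X f \<sigma>"
  shows "gen_choquet X \<delta> circ \<mu> f = choquet_sum X \<delta> circ \<mu> f \<sigma>"
proof -
  define \<tau> where "\<tau> = (SOME \<sigma>. sorting_perm X f \<sigma>)"
  have \<tau>: "sorting_perm X f \<tau>"
    unfolding \<tau>_def by (rule someI_ex[OF sorting_perm_exists[OF assms(1)]])
  have img: "\<rho> k \<in> X" if "sorting_perm X f \<rho>" "1 \<le> k" "k \<le> card X" for \<rho> k
    using that by (auto simp: sorting_perm_def bij_betw_def)
  have pos: "0 \<le> ordered_value f \<rho> i" if "sorting_perm X f \<rho>" "i \<le> card X" for \<rho> i
    using img[OF that(1), of i] that(2) assms(3)
    by (auto simp: ordered_value_def nonneg_fun_def)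
  have B: "\<rho> ` {i..card X} = {x \<in> X. ordered_value f \<rho> i \<le> f x}"
    if \<rho>: "sorting_perm X f \<rho>" and i: "1 \<le> i" "i \<le> card X"
      and neq: "ordered_value f \<rho> i \<noteq> ordered_value f \<rho> (i - 1)" for \<rho> i
  proof (intro equalityI subsetI)
    fix x assume "x \<in> \<rho> ` {i..card X}"
    then show "x \<in> {x \<in> X. ordered_value f \<rho> i \<le> f x}"
      using \<rho> i img[OF \<rho>] by (auto simp: sorting_perm_def ordered_value_def)
  next
    fix x assume x: "x \<in> {x \<in> X. ordered_value f \<rho> i \<le> f x}"
    moreover have "X = \<rho> ` {1..card X}"
      using \<rho> by (simp add: sorting_perm_def bij_betw_def)
    ultimately have "x \<in> \<rho> ` {1..card X}" by blast
    then obtain k where k: "1 \<le> k" "k \<le> card X" "x = \<rho> k" by auto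
    have "i \<le> k"
    proof (rule ccontr)
      assume "\<not> i \<le> k"
      then have "k \<le> i - 1" "i - 1 \<noteq> 0" using k(1) by auto
      then have "f (\<rho> k) \<le> f (\<rho> (i - 1))" "f (\<rho> (i - 1)) \<le> f (\<rho> i)"
        using \<rho> k i by (auto simp: sorting_perm_def)
      then show False
        using x k neq i \<open>i - 1 \<noteq> 0\<close> by (auto simp: ordered_value_def)
    qed
    then show "x \<in> \<rho> ` {i..card X}" using k by auto
  qed
  have "circ (\<delta> (ordered_value f \<tau> i) (ordered_value f \<tau> (i - 1))) (\<mu> (\<tau> ` {i..card X})) =
        circ (\<delta> (ordered_value f \<sigma> i) (ordered_value f \<sigma> (i - 1))) (\<mu> (\<sigma> ` {i..card X}))"
    if i: "1 \<le> i" "i \<le> card X" for i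
  proof -
    have e: "ordered_value f \<tau> i = ordered_value f \<sigma> i"
            "ordered_value f \<tau> (i - 1) = ordered_value f \<sigma> (i - 1)"
      using ordered_value_unique[OF \<tau> assms(6)] i by auto
    have m: "0 \<le> \<mu> (\<rho> ` {i..card X})" if "sorting_perm X f \<rho>" for \<rho>
    proof -
      have "\<rho> ` {i..card X} \<subseteq> X" using img[OF that] i by auto
      then show ?thesis using assms(4) by (simp add: monotone_measure_def)
    qed
    show ?thesis
    proof (cases "ordered_value f \<sigma> i = ordered_value f \<sigma> (i - 1)")
      case True
      have "\<delta> (ordered_value f \<sigma> i) (ordered_value f \<sigma> (i - 1)) = 0"
        using assms(2) True pos[OF assms(6), of i] i by (auto simp: dissimilarity_def)
      then show ?thesis using e assms(5) m[OF \<tau>] m[OF assms(6)] by simp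
    next
      case False
      then show ?thesis using B[OF \<tau> i] B[OF assms(6) i] e by simp
    qed
  qed
  then show ?thesis
    unfolding gen_choquet_def \<tau>_def[symmetric] choquet_sum_def by (intro sum.cong) auto
qed

end

theory Submission
  imports Defs
begin

text \<open>Let \<open>X = {a, b}\<close> with \<open>f a \<le> f b\<close>. The chain \<open>{b} \<subset> X\<close> contributes exactly the generalised
  Choquet sum. It dominates the chains \<open>X\<close> and \<open>{a}\<close> by monotonicity, and the chain
  \<open>{a} \<subset> X\<close> because of symmetry of \<open>\<mu>\<close> or because \<open>circ 0 b = 0\<close>. Only the chain \<open>{b}\<close> is not
  dominated in general, and it is dominated under the inequality (*). Conversely, the measure
  equal to \<open>y\<close> on all nonempty sets turns domination of \<open>{b}\<close> into (*).\<close>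

section \<open>Sums along chains in a two-element set\<close>

definition chain_sum ::
  "(real \<Rightarrow> real \<Rightarrow> real) \<Rightarrow> (real \<Rightarrow> real \<Rightarrow> real) \<Rightarrow> ('a \<Rightarrow> real) \<Rightarrow> ('a set \<Rightarrow> real)
    \<Rightarrow> nat \<Rightarrow> (nat \<Rightarrow> 'a set) \<Rightarrow> real"
where
  "chain_sum \<delta> circ f \<mu> l D =
     (\<Sum>i=1..l. circ (\<delta> (A_inf f (D i)) (A_inf f (D (i - 1)))) (\<mu> (D i)))"

lemma CS_altdef: "CS X \<delta> circ f \<mu> = Sup {chain_sum \<delta> circ f \<mu> l D | l D. chain_enum X l D}"
  by (simp add: CS_def chain_sum_def)

lemma A_inf_empty [simp]: "A_inf f {} = 0"
  by (simp add: A_inf_def)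

lemma A_inf_singleton [simp]: "A_inf f {x} = f x"
  by (simp add: A_inf_def)

lemma A_inf_pair:
  assumes "f a \<le> f b"
  shows "A_inf f {a, b} = f a"
  using assms by (simp add: A_inf_def cInf_eq_Min)

text \<open>A strict inclusion between nonempty subsets of a pair forces the larger one to be the
  pair and the smaller one to be a singleton, so a third member cannot fit. The rule speaks of
  enumerations rather than families because the sums are indexed by them.\<close>

lemma chain_enum_pair_cases:
  assumes "chain_enum {a, b} l D"
  obtains (single) "l = 1" "D 0 = {}" "D 1 \<in> {{a}, {b}, {a, b}}"
    | (double) "l = 2" "D 0 = {}" "D 1 = {a, b}" "D 2 \<in> {{a}, {b}}"
proof -
  have l: "1 \<le> l" and D0: "D 0 = {}"
    and ne: "\<And>i. 1 \<le> i \<Longrightarrow> i \<le> l \<Longrightarrow> D i \<noteq> {} \<and> D i \<subseteq> {a, b}"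
    and dec: "\<And>i. 1 \<le> i \<Longrightarrow> i < l \<Longrightarrow> D (Suc i) \<subset> D i"
    using assms by (auto simp: chain_enum_def)
  have D1: "D 1 \<in> {{a}, {b}, {a, b}}"
    using ne[of 1] l by auto
  have D2: "D 1 = {a, b} \<and> D 2 \<in> {{a}, {b}}" if "2 \<le> l"
    using dec[of 1] ne[of 1] ne[of 2] that by (auto simp: numeral_2_eq_2)
  have "\<not> 3 \<le> l"
  proof
    assume "3 \<le> l"
    then show False
      using D2 dec[of 2] ne[of 3] by (auto simp: eval_nat_numeral)
  qed
  then consider "l = 1" | "l = 2"
    using l by linarith
  then show thesis
    by cases (use that D0 D1 D2 in auto)
qed

lemma chain_sum_one:
  assumes "D 0 = {}"
  shows "chain_sum \<delta> circ f \<mu> 1 D = circ (\<delta> (A_inf f (D 1)) 0) (\<mu> (D 1))"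
  using assms by (simp add: chain_sum_def)

lemma chain_sum_two:
  assumes "D 0 = {}"
  shows "chain_sum \<delta> circ f \<mu> 2 D =
    circ (\<delta> (A_inf f (D 1)) 0) (\<mu> (D 1)) + circ (\<delta> (A_inf f (D 2)) (A_inf f (D 1))) (\<mu> (D 2))"
  using assms by (simp add: chain_sum_def numeral_2_eq_2)

text \<open>The ordering of \<open>f a\<close> and \<open>f b\<close> turns the infimum over the
  pair into \<open>f a\<close>. The values belong, in this order, to the chains \<open>{a}\<close>,
  \<open>{b}\<close>, \<open>{a, b}\<close>, \<open>{a}\<close> below the pair and
  \<open>{b}\<close> below the pair. The term \<open>\<delta> (f a) (f a)\<close> stays because
  \<open>\<delta>\<close> is arbitrary here.\<close>

lemma chain_sums_pair:
  assumes "a \<noteq> b" "f a \<le> f b"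
  shows "{chain_sum \<delta> circ f \<mu> l D | l D. chain_enum {a, b} l D} =
    {circ (\<delta> (f a) 0) (\<mu> {a}),
     circ (\<delta> (f b) 0) (\<mu> {b}),
     circ (\<delta> (f a) 0) (\<mu> {a, b}),
     circ (\<delta> (f a) 0) (\<mu> {a, b}) + circ (\<delta> (f a) (f a)) (\<mu> {a}),
     circ (\<delta> (f a) 0) (\<mu> {a, b}) + circ (\<delta> (f b) (f a)) (\<mu> {b})}" (is "_ = ?R")
proof -
  define L where "L = {chain_sum \<delta> circ f \<mu> l D | l D. chain_enum {a, b} l D}"
  note inf = A_inf_pair[of f a b, OF assms(2)]
  have L_intro: "chain_sum \<delta> circ f \<mu> l D \<in> L" if "chain_enum {a, b} l D" for l D
    using that unfolding L_def by blast
  have "v \<in> ?R" if "v \<in> L" for v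
  proof -
    from that obtain l D where v: "v = chain_sum \<delta> circ f \<mu> l D" and D: "chain_enum {a, b} l D"
      unfolding L_def by blast
    show ?thesis
      using D
    proof (cases rule: chain_enum_pair_cases)
      case single
      have "v = circ (\<delta> (A_inf f (D 1)) 0) (\<mu> (D 1))"
        unfolding v single(1) by (rule chain_sum_one[of D, OF single(2)])
      then show ?thesis
        using single(3) inf by (elim insertE emptyE) simp_all
    next
      case double
      have "v = circ (\<delta> (f a) 0) (\<mu> {a, b}) + circ (\<delta> (A_inf f (D 2)) (f a)) (\<mu> (D 2))"
        unfolding v double(1) chain_sum_two[of D, OF double(2)] double(3) inf ..
      then show ?thesis
        using double(4) by (elim insertE emptyE) simp_all
    qed
  qed
  then have "L \<subseteq> ?R"
    by blast
  have one: "circ (\<delta> (A_inf f S) 0) (\<mu> S) \<in> L" if "S \<in> {{a}, {b}, {a, b}}" for S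
  proof -
    \<comment> \<open>Index 0 carries the convention of the empty set; beyond its length an
      enumeration is unconstrained, so a constant will do.\<close>
    let ?D = "\<lambda>i::nat. if i = 0 then {} else S"
    have "S \<noteq> {} \<and> S \<subseteq> {a, b}"
      using that by (elim insertE emptyE) simp_all
    then have "chain_enum {a, b} 1 ?D"
      by (simp add: chain_enum_def)
    moreover have "chain_sum \<delta> circ f \<mu> 1 ?D = circ (\<delta> (A_inf f S) 0) (\<mu> S)"
      by (simp add: chain_sum_def)
    ultimately show ?thesis
      using L_intro[of 1 ?D] by simp
  qed
  have two: "circ (\<delta> (f a) 0) (\<mu> {a, b}) + circ (\<delta> (A_inf f S) (f a)) (\<mu> S) \<in> L"
    if "S \<in> {{a}, {b}}" for S
  proof -
    let ?D = "\<lambda>i::nat. if i = 0 then {} else if i = 1 then {a, b} else S"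
    have "S \<noteq> {} \<and> S \<subset> {a, b}"
      using that assms(1) by (elim insertE emptyE) auto
    then have "chain_enum {a, b} 2 ?D"
      by (auto simp: chain_enum_def)
    moreover have "chain_sum \<delta> circ f \<mu> 2 ?D =
        circ (\<delta> (f a) 0) (\<mu> {a, b}) + circ (\<delta> (A_inf f S) (f a)) (\<mu> S)"
      using inf by (simp add: chain_sum_two)
    ultimately show ?thesis
      using L_intro[of 2 ?D] by simp
  qed
  have "?R \<subseteq> L"
    using one[of "{a}"] one[of "{b}"] one[of "{a, b}"] two[of "{a}"] two[of "{b}"]
    unfolding inf by simp
  with \<open>L \<subseteq> ?R\<close> have "L = ?R"
    by (rule equalityI)
  then show ?thesis
    unfolding L_def .
qed

section \<open>The supremum as a maximum of five values\<close>

lemma CS_pair: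
  assumes "a \<noteq> b" "f a \<le> f b"
  shows "CS {a, b} \<delta> circ f \<mu> = Max
    {circ (\<delta> (f a) 0) (\<mu> {a}),
     circ (\<delta> (f b) 0) (\<mu> {b}),
     circ (\<delta> (f a) 0) (\<mu> {a, b}),
     circ (\<delta> (f a) 0) (\<mu> {a, b}) + circ (\<delta> (f a) (f a)) (\<mu> {a}),
     circ (\<delta> (f a) 0) (\<mu> {a, b}) + circ (\<delta> (f b) (f a)) (\<mu> {b})}"
  unfolding CS_altdef chain_sums_pair[of a b f \<delta> circ \<mu>, OF assms]
  by (rule cSup_eq_Max) simp_all

lemma monotone_measureD:
  assumes "monotone_measure X \<mu>" "C \<subseteq> D" "D \<subseteq> X"
  shows "0 \<le> \<mu> C" "\<mu> C \<le> \<mu> D"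
  using assms subset_trans[OF assms(2,3)] unfolding monotone_measure_def by simp_all

lemma symmetric_measureD:
  assumes "symmetric_measure X \<mu>" "C \<subseteq> X" "D \<subseteq> X" "card C = card D"
  shows "\<mu> C = \<mu> D"
  using assms unfolding symmetric_measure_def by blast

lemma nondecreasing_op_nonneg:
  assumes "nondecreasing_op circ" "0 \<le> a" "0 \<le> b"
  shows "0 \<le> circ a b"
  using assms unfolding nondecreasing_op_def by simp

lemma nondecreasing_op_mono:
  assumes "nondecreasing_op circ" "0 \<le> a" "0 \<le> b" "a \<le> c" "b \<le> d"
  shows "circ a b \<le> circ c d"
  using assms order_trans[OF assms(2,4)] order_trans[OF assms(3,5)]
  unfolding nondecreasing_op_def by simp

text \<open>Monotonicity and nonnegativity put the chains \<open>{a}\<close> and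
  \<open>{a, b}\<close> below the last value. The chain \<open>{a}\<close> below the pair has second
  summand \<open>circ 0 (\<mu> {a})\<close>, which need not vanish, and \<open>\<mu> {a}\<close> may
  exceed \<open>\<mu> {b}\<close>; \<open>constant_term\<close> covers it. Only the chain
  \<open>{b}\<close> remains to be compared.\<close>

lemma CS_pair_eq_double_chain_iff:
  assumes \<delta>: "dissimilarity \<delta>" and circ: "nondecreasing_op circ"
    and \<mu>: "monotone_measure {a, b} \<mu>"
    and ab: "a \<noteq> b" "0 \<le> f a" "f a \<le> f b"
    and constant_term: "circ 0 (\<mu> {a}) \<le> circ (\<delta> (f b) (f a)) (\<mu> {b})"
  shows "CS {a, b} \<delta> circ f \<mu> =
           circ (\<delta> (f a) 0) (\<mu> {a, b}) + circ (\<delta> (f b) (f a)) (\<mu> {b}) \<longleftrightarrow>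
         circ (\<delta> (f b) 0) (\<mu> {b}) \<le>
           circ (\<delta> (f a) 0) (\<mu> {a, b}) + circ (\<delta> (f b) (f a)) (\<mu> {b})"
proof -
  have \<delta>_f: "0 \<le> \<delta> (f a) 0" "0 \<le> \<delta> (f b) (f a)" "\<delta> (f a) (f a) = 0"
    using \<delta> ab by (auto simp: dissimilarity_def)
  have "0 \<le> circ (\<delta> (f b) (f a)) (\<mu> {b})"
    by (rule nondecreasing_op_nonneg[OF circ \<delta>_f(2) monotone_measureD(1)[OF \<mu>]]) auto
  moreover have "circ (\<delta> (f a) 0) (\<mu> {a}) \<le> circ (\<delta> (f a) 0) (\<mu> {a, b})"
    by (rule nondecreasing_op_mono[OF circ \<delta>_f(1) monotone_measureD(1)[OF \<mu>] order_refl
          monotone_measureD(2)[OF \<mu>]]) auto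
  ultimately show ?thesis
    unfolding CS_pair[of a b f \<delta> circ \<mu>, OF ab(1,3)] \<delta>_f(3)
    using constant_term by (subst Max_eq_iff) auto
qed

section \<open>The generalised Choquet sum on two points\<close>

lemma sorting_perm_pair:
  assumes "a \<noteq> b" "f a \<le> f b"
  shows "sorting_perm {a, b} f (\<lambda>i. if i = 1 then a else b)"
proof -
  have "{1..card {a, b}} = {1, 2}"
    using assms(1) by auto
  then show ?thesis
    using assms by (auto simp: sorting_perm_def bij_betw_def inj_on_def le_Suc_eq)
qed

text \<open>The upper sets of this permutation are \<open>{a, b}\<close> and \<open>{b}\<close>, so
  they form the chain of \<open>{b}\<close> below the pair.\<close>

lemma choquet_sum_pair:
  assumes "a \<noteq> b"
  shows "choquet_sum {a, b} \<delta> circ \<mu> f (\<lambda>i. if i = 1 then a else b) =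
    circ (\<delta> (f a) 0) (\<mu> {a, b}) + circ (\<delta> (f b) (f a)) (\<mu> {b})"
proof -
  have sum: "(\<Sum>i=1..2. F i) = F 1 + F 2" for F :: "nat \<Rightarrow> real"
    by (simp add: numeral_2_eq_2)
  have "{1..2::nat} = {1, 2}" "{2..2::nat} = {2}"
    by auto
  then have image: "(\<lambda>i. if i = 1 then a else b) ` {1..2::nat} = {a, b}"
    "(\<lambda>i. if i = 1 then a else b) ` {2..2::nat} = {b}"
    by auto
  have "card {a, b} = 2"
    using assms by simp
  then show ?thesis
    unfolding choquet_sum_def by (simp only: sum image) (simp add: ordered_value_def)
qed

text \<open>The disjunction enters twice: it bounds the term \<open>circ 0 (\<mu> {a})\<close>, and
  it allows the permutation chosen by \<open>SOME\<close> in \<open>gen_choquet\<close> to be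
  replaced by the explicit one.\<close>

lemma CS_pair_eq_gen_choquet_iff:
  assumes "dissimilarity \<delta>" "nondecreasing_op circ" "monotone_measure {a, b} \<mu>"
    and "a \<noteq> b" "nonneg_fun {a, b} f" "f a \<le> f b"
    and "symmetric_measure {a, b} \<mu> \<or> (\<forall>c\<ge>0. circ 0 c = 0)"
  shows "CS {a, b} \<delta> circ f \<mu> = gen_choquet {a, b} \<delta> circ \<mu> f \<longleftrightarrow>
         circ (\<delta> (f b) 0) (\<mu> {b}) \<le>
           circ (\<delta> (f a) 0) (\<mu> {a, b}) + circ (\<delta> (f b) (f a)) (\<mu> {b})"
proof -
  have \<mu>: "0 \<le> \<mu> {a}" "0 \<le> \<mu> {b}"
    by (rule monotone_measureD(1)[OF assms(3) _ order_refl]; simp)+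
  have f: "0 \<le> f a" "0 \<le> f b"
    using assms(5) by (auto simp: nonneg_fun_def)
  have \<delta>: "0 \<le> \<delta> (f b) (f a)"
    using assms(1) f by (auto simp: dissimilarity_def)
  have mono: "circ 0 (\<mu> {b}) \<le> circ (\<delta> (f b) (f a)) (\<mu> {b})"
    by (rule nondecreasing_op_mono[OF assms(2) order_refl \<mu>(2) \<delta> order_refl])
  \<comment> \<open>Under symmetry the arguments agree; in the other case both sides are 0.\<close>
  have "circ 0 (\<mu> {a}) = circ 0 (\<mu> {b})"
    using assms(7)
  proof
    assume "symmetric_measure {a, b} \<mu>"
    then have "\<mu> {a} = \<mu> {b}"
      by (rule symmetric_measureD) simp_all
    then show ?thesis
      by simp
  qed (use \<mu> in simp)
  then have "circ 0 (\<mu> {a}) \<le> circ (\<delta> (f b) (f a)) (\<mu> {b})"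
    using mono by simp
  note iff = CS_pair_eq_double_chain_iff[OF assms(1-4) f(1) assms(6) this]
  note sorting = sorting_perm_pair[of a b f, OF assms(4,6)]
  have "gen_choquet {a, b} \<delta> circ \<mu> f =
      choquet_sum {a, b} \<delta> circ \<mu> f (\<lambda>i. if i = 1 then a else b)"
    using assms(7)
  proof
    assume "symmetric_measure {a, b} \<mu>"
    then show ?thesis
      by (intro gen_choquet_eq_symmetric[OF _ _ sorting]) simp_all
  next
    assume "\<forall>c\<ge>0. circ 0 c = 0"
    then show ?thesis
      by (intro gen_choquet_eq_zero[OF _ assms(1,5,3) _ sorting]) simp_all
  qed
  then show ?thesis
    unfolding choquet_sum_pair[OF assms(4)] using iff by simp
qed

section \<open>Sufficiency and necessity of the inequality\<close>

lemma CS_pair_eq_gen_choquet: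
  assumes "dissimilarity \<delta>" "nondecreasing_op circ" "monotone_measure {a, b} \<mu>"
    and "a \<noteq> b" "nonneg_fun {a, b} f"
    and "symmetric_measure {a, b} \<mu> \<or> (\<forall>c\<ge>0. circ 0 c = 0)"
    and ineq: "\<And>x1 x2 y. 0 \<le> x1 \<Longrightarrow> x1 \<le> x2 \<Longrightarrow> 0 \<le> y \<Longrightarrow>
          circ (\<delta> x2 0) y \<le> circ (\<delta> x1 0) y + circ (\<delta> x2 x1) y"
  shows "CS {a, b} \<delta> circ f \<mu> = gen_choquet {a, b} \<delta> circ \<mu> f"
  using assms(3-6)
\<comment> \<open>Exchanging \<open>a\<close> and \<open>b\<close> leaves the set
  \<open>{a, b}\<close> and hence the claim unchanged, so \<open>f a \<le> f b\<close> may be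
  assumed.\<close>
proof (induction "f a" "f b" arbitrary: a b rule: linorder_wlog)
  case (le a b)
  have \<mu>: "0 \<le> \<mu> {b}" "\<mu> {b} \<le> \<mu> {a, b}"
    using le(2) by (auto simp: monotone_measure_def)
  have fa: "0 \<le> f a"
    using le(4) by (simp add: nonneg_fun_def)
  then have "0 \<le> \<delta> (f a) 0"
    using assms(1) by (simp add: dissimilarity_def)
  then have "circ (\<delta> (f a) 0) (\<mu> {b}) \<le> circ (\<delta> (f a) 0) (\<mu> {a, b})"
    using assms(2) \<mu> by (auto simp: nondecreasing_op_def)
  \<comment> \<open>The inequality is taken at \<open>y = \<mu> {b}\<close>; the previous step then
    enlarges the measure in the first summand to \<open>\<mu> {a, b}\<close>.\<close>
  then have "circ (\<delta> (f b) 0) (\<mu> {b}) \<le>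
      circ (\<delta> (f a) 0) (\<mu> {a, b}) + circ (\<delta> (f b) (f a)) (\<mu> {b})"
    using ineq[OF fa le(1) \<mu>(1)] by linarith
  then show ?case
    using CS_pair_eq_gen_choquet_iff[OF assms(1,2) le(2-4,1,5)] by blast
next
  case (sym a b)
  then show ?case
    using sym(1)[OF refl refl] by (simp add: insert_commute)
qed

text \<open>One function and one measure suffice as a test. The measure is symmetric, so the same
  test serves both equivalences.\<close>

lemma ineq_of_CS_pair_eq_gen_choquet:
  assumes "dissimilarity \<delta>" "nondecreasing_op circ" "a \<noteq> b"
    and eq: "\<And>f \<mu>. nonneg_fun {a, b} f \<Longrightarrow> monotone_measure {a, b} \<mu> \<Longrightarrow>
          symmetric_measure {a, b} \<mu> \<Longrightarrow>
          CS {a, b} \<delta> circ f \<mu> = gen_choquet {a, b} \<delta> circ \<mu> f"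
    and "0 \<le> x1" "x1 \<le> x2" "0 \<le> y"
  shows "circ (\<delta> x2 0) y \<le> circ (\<delta> x1 0) y + circ (\<delta> x2 x1) y"
proof -
  define f where "f = (\<lambda>i. if i = a then x1 else x2)"
  \<comment> \<open>All three measure values in the criterion become \<open>y\<close>.\<close>
  define \<mu> where "\<mu> = (\<lambda>C :: 'a set. if C = {} then 0 else y)"
  have \<mu>: "monotone_measure {a, b} \<mu>"
    using assms(7) by (auto simp: monotone_measure_def \<mu>_def)
  \<comment> \<open>Here \<open>\<mu>\<close> only sees emptiness, which \<open>card\<close> detects
    on finite sets.\<close>
  have sym: "symmetric_measure {a, b} \<mu>"
    unfolding symmetric_measure_def \<mu>_def
    by (metis card_eq_0_iff finite.emptyI finite_insert finite_subset)
  have f: "nonneg_fun {a, b} f" "f a \<le> f b"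
    using assms(3,5,6) by (auto simp: nonneg_fun_def f_def)
  have "circ (\<delta> (f b) 0) (\<mu> {b}) \<le>
      circ (\<delta> (f a) 0) (\<mu> {a, b}) + circ (\<delta> (f b) (f a)) (\<mu> {b})"
    using CS_pair_eq_gen_choquet_iff[OF assms(1,2) \<mu> assms(3) f] sym eq[OF f(1) \<mu> sym] by blast
  then show ?thesis
    using assms(3) by (simp add: f_def \<mu>_def)
qed

theorem theorem4p8:
  fixes \<delta> circ :: "real \<Rightarrow> real \<Rightarrow> real"
  assumes "dissimilarity \<delta>" and "nondecreasing_op circ"
  shows "((\<forall>(f :: nat \<Rightarrow> real) \<mu>.
             nonneg_fun {1, 2} f \<longrightarrow> monotone_measure {1, 2} \<mu> \<longrightarrow> symmetric_measure {1, 2} \<mu> \<longrightarrow>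
             CS {1, 2} \<delta> circ f \<mu> = gen_choquet {1, 2} \<delta> circ \<mu> f)
          \<longleftrightarrow>
          (\<forall>x1 x2 y. 0 \<le> x1 \<longrightarrow> x1 \<le> x2 \<longrightarrow> 0 \<le> y \<longrightarrow>
             circ (\<delta> x2 0) y \<le> circ (\<delta> x1 0) y + circ (\<delta> x2 x1) y))
       \<and>
         ((\<forall>a\<ge>0. circ 0 a = 0) \<longrightarrow>
          ((\<forall>(f :: nat \<Rightarrow> real) \<mu>.
             nonneg_fun {1, 2} f \<longrightarrow> monotone_measure {1, 2} \<mu> \<longrightarrow>
             CS {1, 2} \<delta> circ f \<mu> = gen_choquet {1, 2} \<delta> circ \<mu> f)
           \<longleftrightarrow>
           (\<forall>x1 x2 y. 0 \<le> x1 \<longrightarrow> x1 \<le> x2 \<longrightarrow> 0 \<le> y \<longrightarrow>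
             circ (\<delta> x2 0) y \<le> circ (\<delta> x1 0) y + circ (\<delta> x2 x1) y)))"
proof -
  have neq: "1 \<noteq> (2 :: nat)"
    by simp
  note suff = CS_pair_eq_gen_choquet[OF assms _ neq]
  note nec = ineq_of_CS_pair_eq_gen_choquet[OF assms neq]
  show ?thesis
  proof (intro conjI impI iffI allI)
    fix x1 x2 y :: real
    assume "\<forall>f \<mu>. nonneg_fun {1, 2} f \<longrightarrow> monotone_measure {1, 2} \<mu> \<longrightarrow>
        symmetric_measure {1, 2} \<mu> \<longrightarrow> CS {1, 2 :: nat} \<delta> circ f \<mu> = gen_choquet {1, 2} \<delta> circ \<mu> f"
      and "0 \<le> x1" "x1 \<le> x2" "0 \<le> y"
    then show "circ (\<delta> x2 0) y \<le> circ (\<delta> x1 0) y + circ (\<delta> x2 x1) y"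
      by (intro nec) simp_all
  next
    fix x1 x2 y :: real
    assume "\<forall>f \<mu>. nonneg_fun {1, 2} f \<longrightarrow> monotone_measure {1, 2} \<mu> \<longrightarrow>
        CS {1, 2 :: nat} \<delta> circ f \<mu> = gen_choquet {1, 2} \<delta> circ \<mu> f"
      and "0 \<le> x1" "x1 \<le> x2" "0 \<le> y"
    \<comment> \<open>Equality for all monotone measures includes the symmetric ones.\<close>
    then show "circ (\<delta> x2 0) y \<le> circ (\<delta> x1 0) y + circ (\<delta> x2 x1) y"
      by (intro nec) simp_all
  \<comment> \<open>The two sufficiency directions remain; each supplies one side of the disjunction
    in \<open>suff\<close>.\<close>
  qed (rule suff; simp)+
qed

end
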